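(* Let $p$ be an odd prime and $m\ge 1$ an integer. The cycle index of the permutation group $\mathcal{U}_{p^m}$ acting on $\mathbb{Z}_{p^m}$ is $$\mathcal{Z}_{(\mathcal{U}_{p^m},\mathbb{Z}_{p^m})}=\frac{1}{\phi(p^m)}\sum_{k=1}^{\phi(p^m)}\ \prod_{i=0}^m x_{u(i,k)}^{v(i,k)},$$ where $v(i,k)=\gcd(\phi(p^i),k)$ and $u(i,k)=\dfrac{\phi(p^i)}{v(i,k)}$.
   Context: $\phi$ is Euler's phi function. $\mathbb{Z}_n$ is the set of residues modulo $n$. $\mathcal{U}_n=\mathrm{Aut}(\mathbb{Z}_n)$ is identified with the set of residues $a$ modulo $n$ with $\gcd(a,n)=1$, where $a$ corresponds to the map $\pi_a(x)=ax \pmod n$; it acts on the $n$ points of $\mathbb{Z}_n$ by multiplication. For a permutation $\pi$ of a finite set with $N$ elements, $\mathrm{ctype}(\pi)=\prod_{i=1}^N x_i^{\lambda_i(\pi)}$, where $x_1,x_2,\dots$ are formal indeterminates and $\lambda_i(\pi)$ is the number of cycles of length $i$ (fixed points counted as cycles of length 1) in the disjoint cycle decomposition of $\pi$. The cycle index of a finite permutation group $G$ on a finite set $P$ is $\mathcal{Z}_{(G,P)}=\frac{1}{|G|}\sum_{\pi\in G}\mathrm{ctype}(\pi)$. *)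

theory Defs
  imports
    Complex_Main
    "HOL-Library.Poly_Mapping"
    "HOL-Combinatorics.Orbits"
    "HOL-Number_Theory.Number_Theory"
    "HOL-Algebra.Bij"
    "HOL-Algebra.Elementary_Groups"
begin

text \<open>
  Polynomials with rational coefficients in the indeterminates
  \<open>x\<^sub>0, x\<^sub>1, x\<^sub>2, \<dots>\<close>: a monomial is its finitely supported
  exponent vector, and a polynomial maps finitely many monomials to nonzero coefficients.
  The ring operations are those of \<^theory>\<open>HOL-Library.Poly_Mapping\<close>.
  The indeterminate \<open>x\<^sub>0\<close> is never used, since there are no cycles of length 0.
\<close>

type_synonym ratpoly = "(nat \<Rightarrow>\<^sub>0 nat) \<Rightarrow>\<^sub>0 rat"

definition indet :: "nat \<Rightarrow> ratpoly" where
  "indet i = Poly_Mapping.single (Poly_Mapping.single i 1) 1"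

definition const_poly :: "rat \<Rightarrow> ratpoly" where
  "const_poly c = Poly_Mapping.single 0 c"

text \<open>
  A permutation of a finite set \<open>P\<close> is an element of \<^term>\<open>Bij P\<close>: a bijection of
  \<open>P\<close> onto itself that is \<open>undefined\<close> outside \<open>P\<close>. Only orbits of points of
  \<open>P\<close> are counted below, so the values outside \<open>P\<close> play no role.
\<close>

definition num_cycles :: "('a \<Rightarrow> 'a) \<Rightarrow> 'a set \<Rightarrow> nat \<Rightarrow> nat" where
  "num_cycles \<pi> P i = card {C \<in> orbit \<pi> ` P. card C = i}"

definition ctype :: "('a \<Rightarrow> 'a) \<Rightarrow> 'a set \<Rightarrow> ratpoly" where
  "ctype \<pi> P = (\<Prod>i = 1..card P. indet i ^ num_cycles \<pi> P i)"

text \<open>Meaningful for finite \<open>P\<close> and \<open>G\<close> a subgroup of \<^term>\<open>BijGroup P\<close>.\<close>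

definition cycle_index :: "('a \<Rightarrow> 'a) set \<Rightarrow> 'a set \<Rightarrow> ratpoly" where
  "cycle_index G P = const_poly (1 / of_nat (card G)) * (\<Sum>\<pi>\<in>G. ctype \<pi> P)"

abbreviation residues_mod :: "nat \<Rightarrow> int set" where
  "residues_mod n \<equiv> carrier (integer_mod_group n)"

definition aut_residues :: "nat \<Rightarrow> (int \<Rightarrow> int) set" where
  "aut_residues n = auto (integer_mod_group n)"

definition mult_map :: "nat \<Rightarrow> int \<Rightarrow> int \<Rightarrow> int" where
  "mult_map n a = (\<lambda>x\<in>residues_mod n. a * x mod int n)"

lemma aut_residues_subgroup: "subgroup (aut_residues n) (BijGroup (residues_mod n))"
  unfolding aut_residues_def by (rule group.subgroup_auto) simp

lemma residues_mod_eq: "n > 0 \<Longrightarrow> residues_mod n = {0..<int n}"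
  by (simp add: carrier_integer_mod_group)

lemma mult_map_in_aut_residues:
  assumes n: "n > 0" and a: "coprime a (int n)"
  shows "mult_map n a \<in> aut_residues n"
proof -
  have inj: "inj_on (mult_map n a) {0..<int n}"
  proof (rule inj_onI)
    fix x y assume xy: "x \<in> {0..<int n}" "y \<in> {0..<int n}" "mult_map n a x = mult_map n a y"
    then have "[a * x = a * y] (mod int n)"
      using n by (simp add: mult_map_def residues_mod_eq cong_def)
    with a have "[x = y] (mod int n)"
      by (simp add: cong_mult_lcancel)
    with xy show "x = y" by (simp add: cong_def)
  qed
  have into: "mult_map n a ` {0..<int n} \<subseteq> {0..<int n}"
    using n by (auto simp: mult_map_def residues_mod_eq)
  have "bij_betw (mult_map n a) {0..<int n} {0..<int n}"
    using inj into by (simp add: bij_betw_def endo_inj_surj)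
  moreover have "mult_map n a \<in> extensional {0..<int n}"
    using n by (simp add: mult_map_def residues_mod_eq)
  moreover have "mult_map n a \<in> hom (integer_mod_group n) (integer_mod_group n)"
    using n by (auto simp: hom_def mult_map_def residues_mod_eq mult_integer_mod_group
        mod_simps algebra_simps)
  ultimately show ?thesis
    using n by (simp add: aut_residues_def auto_def Bij_def residues_mod_eq)
qed

lemma aut_residues_eq:
  assumes n: "n > 0"
  shows "aut_residues n = mult_map n ` {a \<in> residues_mod n. coprime a (int n)}"
proof (intro equalityI subsetI)
  fix f assume "f \<in> aut_residues n"
  then have hom: "f \<in> hom (integer_mod_group n) (integer_mod_group n)"
    and ext: "f \<in> extensional {0..<int n}" and bij: "bij_betw f {0..<int n} {0..<int n}"
    using n by (auto simp: aut_residues_def auto_def Bij_def residues_mod_eq)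
  have add: "f ((x + y) mod int n) = (f x + f y) mod int n"
    if "x \<in> {0..<int n}" "y \<in> {0..<int n}" for x y
    using hom n that by (auto simp: hom_def residues_mod_eq mult_integer_mod_group)
  have rng: "f x \<in> {0..<int n}" if "x \<in> {0..<int n}" for x
    using bij that by (auto simp: bij_betw_def)
  define a where "a = f (1 mod int n)"
  have a: "a \<in> {0..<int n}" unfolding a_def using n by (intro rng) simp
  have f0: "f 0 = 0"
  proof -
    have "f 0 = (f 0 + f 0) mod int n" using add[of 0 0] n by simp
    with rng[of 0] n have "[f 0 + 0 = f 0 + f 0] (mod int n)" by (simp add: cong_def)
    then have "[0 = f 0] (mod int n)" by (simp only: cong_add_lcancel)
    with rng[of 0] n show ?thesis by (simp add: cong_def)
  qed
  have val: "f (int k) = a * int k mod int n" if "k < n" for k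
    using that
  proof (induction k)
    case (Suc k)
    then have "f ((int k + 1 mod int n) mod int n) = (f (int k) + f (1 mod int n)) mod int n"
      by (intro add) auto
    with Suc show ?case by (simp add: a_def mod_simps algebra_simps)
  qed (simp add: f0)
  have val': "f x = a * x mod int n" if "x \<in> {0..<int n}" for x
    using val[of "nat x"] that by (auto simp: nat_less_iff)
  have "1 mod int n \<in> f ` {0..<int n}" using bij n by (simp add: bij_betw_def)
  then obtain x where "x \<in> {0..<int n}" "f x = 1 mod int n" by auto
  with val' have "[a * x = 1] (mod int n)" by (simp add: cong_def)
  then have "coprime a (int n)" by (auto simp: coprime_iff_invertible_int)
  moreover have "f = mult_map n a"
    using ext val' n by (auto simp: mult_map_def residues_mod_eq extensional_def restrict_def)
  ultimately show "f \<in> mult_map n ` {a \<in> residues_mod n. coprime a (int n)}"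
    using a n by (auto simp: residues_mod_eq)
qed (use n mult_map_in_aut_residues in auto)

end

theory Submission
  imports Defs
begin

text \<open>
  Multiplication by \<open>a\<close> preserves \<open>gcd(x, n)\<close>, and \<open>a\<^sup>j x \<equiv> a\<^sup>k x\<close> modulo \<open>n\<close> holds iff
  \<open>a\<^sup>j \<equiv> a\<^sup>k\<close> modulo \<open>d = n / gcd(x, n)\<close>. So all cycles through the \<open>\<phi>(d)\<close> residues with
  \<open>gcd(x, n) = n / d\<close> have length \<open>ord\<^sub>d(a)\<close>. For \<open>n = p\<^sup>m\<close>, some \<open>g\<close> is a primitive root
  modulo all \<open>p\<^sup>i\<close> at once, and \<open>ord(g\<^sup>k) = \<phi>(p\<^sup>i) / gcd(\<phi>(p\<^sup>i), k)\<close> modulo \<open>p\<^sup>i\<close>.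
\<close>

section \<open>Cycle types as products over orbits\<close>

lemma ctype_eq_prod_orbits:
  assumes fin: "finite P" and orb: "\<And>x. x \<in> P \<Longrightarrow> orbit f x \<subseteq> P"
  shows "ctype f P = (\<Prod>C\<in>orbit f ` P. indet (card C))"
proof -
  \<comment> \<open>Since orbits are nonempty and stay inside \<open>P\<close>, the lengths
    \<open>1..card P\<close> in the definition of \<open>ctype\<close> cover every orbit; grouping
    orbits by size then loses none.\<close>
  have "card ` orbit f ` P \<subseteq> {1..card P}"
  proof safe
    fix x assume x: "x \<in> P"
    then have "card (orbit f x) \<le> card P" "finite (orbit f x)"
      using fin orb by (auto intro: card_mono finite_subset)
    then show "card (orbit f x) \<in> {1..card P}"
      by (simp add: Suc_le_eq card_gt_0_iff orbit_nonempty)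
  qed
  then have "(\<Prod>C\<in>orbit f ` P. indet (card C)) =
      (\<Prod>i = 1..card P. \<Prod>C\<in>{C \<in> orbit f ` P. card C = i}. indet (card C))"
    using fin by (intro prod.group [symmetric]) auto
  also have "\<dots> = (\<Prod>i = 1..card P. indet i ^ num_cycles f P i)"
    by (intro prod.cong refl) (simp add: num_cycles_def)
  finally show ?thesis by (simp add: ctype_def)
qed

section \<open>Residues sorted by their gcd with the modulus\<close>

text \<open>For \<open>d dvd n\<close> with \<open>n > 0\<close> these are the elements of additive
  order \<open>d\<close>. Indexing by \<open>d\<close> instead of the gcd makes \<open>d\<close> the
  modulus that governs the cycles through the fibre.\<close>

definition gcd_fibre :: "nat \<Rightarrow> nat \<Rightarrow> int set" where
  "gcd_fibre n d = {x \<in> {0..<int n}. gcd x (int n) = int (n div d)}"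

lemma finite_gcd_fibre [simp]: "finite (gcd_fibre n d)"
  by (rule finite_subset [of _ "{0..<int n}"]) (auto simp: gcd_fibre_def)

lemma card_gcd_fibre:
  assumes n: "n > 0" and d: "d dvd n"
  shows "card (gcd_fibre n d) = totient d"
proof -
  have gcd_mod: "gcd (int (k mod n)) (int n) = int (gcd k n)" for k
    by (simp add: gcd_int_int_eq gcd.commute [of _ n] flip: gcd_red_nat)
  have "bij_betw (\<lambda>k. int (k mod n)) {k\<in>{0<..n}. gcd k n = n div d} (gcd_fibre n d)"
  proof (rule bij_betw_imageI)
    show "inj_on (\<lambda>k. int (k mod n)) {k\<in>{0<..n}. gcd k n = n div d}"
    proof (rule inj_onI)
      fix k l assume "k \<in> {k\<in>{0<..n}. gcd k n = n div d}" "l \<in> {k\<in>{0<..n}. gcd k n = n div d}"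
        and "int (k mod n) = int (l mod n)"
      then show "k = l" by (cases "k = n"; cases "l = n") auto
    qed
    show "(\<lambda>k. int (k mod n)) ` {k\<in>{0<..n}. gcd k n = n div d} = gcd_fibre n d"
    proof (intro equalityI subsetI)
      fix x assume x: "x \<in> gcd_fibre n d"
      \<comment> \<open>The totient count runs over \<open>{0<..n}\<close>, so the residue 0 is
        represented there by \<open>n\<close>.\<close>
      define k where "k = (if x = 0 then n else nat x)"
      have "k \<in> {0<..n}" "int (k mod n) = x"
        using x n by (auto simp: k_def gcd_fibre_def nat_less_iff)
      moreover from this have "gcd k n = n div d"
        using x gcd_mod [of k] by (simp add: gcd_fibre_def)
      ultimately show "x \<in> (\<lambda>k. int (k mod n)) ` {k\<in>{0<..n}. gcd k n = n div d}"
        by (auto intro!: image_eqI [where x = k])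
    qed (use n gcd_mod in \<open>auto simp: gcd_fibre_def\<close>)
  qed
  then have "card (gcd_fibre n d) = card {k\<in>{0<..n}. gcd k n = n div d}"
    by (simp add: bij_betw_same_card)
  also have "\<dots> = totient (n div (n div d))"
    using n d by (intro card_gcd_eq_totient) auto
  also have "n div (n div d) = d"
    using n d by auto
  finally show ?thesis .
qed

lemma Union_gcd_fibre:
  assumes "n > 0"
  shows "(\<Union>d\<in>{d. d dvd n}. gcd_fibre n d) = {0..<int n}"
proof (intro equalityI subsetI)
  fix x assume x: "x \<in> {0..<int n}"
  let ?e = "nat (gcd x (int n))"
  have "?e dvd n" using nat_dvd_iff by force
  then obtain d where d: "n = ?e * d" by (rule dvdE)
  with assms have "d > 0" by (metis mult_0_right neq0_conv)
  with d have "n div d = ?e" by (metis nonzero_mult_div_cancel_right neq0_conv)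
  with x have "x \<in> gcd_fibre n d" by (simp add: gcd_fibre_def)
  moreover have "d dvd n" using d by (metis dvd_triv_right)
  ultimately show "x \<in> (\<Union>d\<in>{d. d dvd n}. gcd_fibre n d)" by blast
qed (auto simp: gcd_fibre_def)

lemma gcd_fibre_disjoint:
  assumes "n > 0" "d dvd n" "d' dvd n" "d \<noteq> d'"
  shows "gcd_fibre n d \<inter> gcd_fibre n d' = {}"
proof -
  have "n div d \<noteq> n div d'"
    using assms by (metis div_mult_swap dvd_div_mult_self mult_left_cancel nat_mult_eq_cancel1
      dvd_div_eq_0_iff mult.commute neq0_conv)
  then show ?thesis by (auto simp: gcd_fibre_def)
qed

section \<open>Cycles of multiplication by a unit\<close>

context
  fixes n a :: nat
  assumes n: "n > 0" and a: "coprime n a"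
begin

lemma funpow_mult_map:
  assumes "x \<in> {0..<int n}"
  shows "(mult_map n (int a) ^^ j) x = int a ^ j * x mod int n"
proof (induction j)
  case (Suc j)
  then show ?case
    using n by (simp add: mult_map_def residues_mod_eq mod_simps mult.assoc)
qed (use assms in simp)

text \<open>Write \<open>n = d * e\<close> and \<open>x = e * y\<close>. The factor \<open>e\<close>
  cancels from the congruence modulo \<open>n\<close>, and \<open>y\<close> is a unit modulo
  \<open>d\<close> because the gcd of \<open>x\<close> and \<open>n\<close> is exactly
  \<open>e\<close>. What remains compares powers of \<open>a\<close> modulo
  \<open>d\<close>.\<close>

lemma funpow_mult_map_eq_iff:
  assumes x: "x \<in> gcd_fibre n d" and d: "d dvd n"
  shows "(mult_map n (int a) ^^ j) x = (mult_map n (int a) ^^ k) x \<longleftrightarrow> [j = k] (mod ord d a)"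
proof -
  define e where "e = n div d"
  have nde: "n = d * e" using d by (simp add: e_def)
  then have d0: "d > 0" and e0: "e > 0" using n by auto
  have g: "gcd x (int n) = int e" using x by (simp add: gcd_fibre_def e_def)
  then obtain y where y: "x = int e * y"
    by (metis dvdE gcd_dvd1)
  have "int e * gcd y (int d) = int e"
    using g by (simp add: y nde mult.commute [of "int d"] gcd_mult_left)
  then have cop: "coprime y (int d)"
    using e0 by (simp add: coprime_iff_gcd_eq_1)
  have "(mult_map n (int a) ^^ j) x = (mult_map n (int a) ^^ k) x \<longleftrightarrow>
      [int a ^ j * x = int a ^ k * x] (mod int n)"
    using x by (simp add: funpow_mult_map gcd_fibre_def cong_def)
  also have "\<dots> \<longleftrightarrow> int e * int d dvd int e * ((int a ^ j - int a ^ k) * y)"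
    by (simp add: cong_iff_dvd_diff y nde algebra_simps)
  also have "\<dots> \<longleftrightarrow> int d dvd (int a ^ j - int a ^ k) * y"
    using e0 by (subst dvd_mult_cancel_left) simp
  also have "\<dots> \<longleftrightarrow> [int (a ^ j) = int (a ^ k)] (mod int d)"
    using cop by (simp add: coprime_dvd_mult_left_iff coprime_commute cong_iff_dvd_diff)
  also have "\<dots> \<longleftrightarrow> [j = k] (mod ord d a)"
    unfolding cong_int_iff using a d
    by (intro order_divides_expdiff) (metis coprime_divisors dvd_refl)
  finally show ?thesis .
qed

lemma orbit_mult_map:
  assumes x: "x \<in> gcd_fibre n d" and d: "d dvd n"
  shows "orbit (mult_map n (int a)) x = (\<lambda>j. (mult_map n (int a) ^^ j) x) ` {..<ord d a}"
proof -
  have "coprime d a" using a d by (metis coprime_divisors dvd_refl)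
  \<comment> \<open>The cycle closes after \<open>ord d a\<close> steps, so boundedly many iterates
    exhaust the orbit.\<close>
  moreover have "(mult_map n (int a) ^^ ord d a) x = (mult_map n (int a) ^^ 0) x"
    by (subst funpow_mult_map_eq_iff [OF x d]) (simp add: cong_def)
  ultimately show ?thesis
    by (subst orbit_altdef_bounded [where n = "ord d a"]) auto
qed

text \<open>An \<open>orbit\<close> is generated from the image of its base point, so membership of
  the point itself needs an argument: \<open>ord d a\<close> is positive, hence exponent 0 is among
  those listed.\<close>

lemma self_in_orbit_mult_map:
  assumes x: "x \<in> gcd_fibre n d" and d: "d dvd n"
  shows "x \<in> orbit (mult_map n (int a)) x"
proof -
  have "coprime d a" using a d by (metis coprime_divisors dvd_refl)
  then show ?thesis
    using orbit_mult_map [OF x d] by (auto intro!: image_eqI [where x = 0])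
qed

lemma card_orbit_mult_map:
  assumes x: "x \<in> gcd_fibre n d" and d: "d dvd n"
  shows "card (orbit (mult_map n (int a)) x) = ord d a"
proof -
  have "inj_on (\<lambda>j. (mult_map n (int a) ^^ j) x) {..<ord d a}"
    by (rule inj_onI) (simp add: funpow_mult_map_eq_iff [OF x d] cong_def)
  then show ?thesis by (simp add: orbit_mult_map [OF x d] card_image)
qed

lemma orbit_mult_map_subset:
  assumes x: "x \<in> gcd_fibre n d"
  shows "orbit (mult_map n (int a)) x \<subseteq> gcd_fibre n d"
proof
  fix y assume "y \<in> orbit (mult_map n (int a)) x"
  then obtain j where y: "y = int a ^ j * x mod int n"
    using x by (auto simp: orbit_altdef funpow_mult_map gcd_fibre_def)
  have "coprime (int n) (int a ^ j)" using a by simp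
  then have "gcd (int n) (int a ^ j * x) = gcd (int n) x"
    by (rule gcd_mult_right_left_cancel)
  then show "y \<in> gcd_fibre n d"
    using x n by (simp add: y gcd_fibre_def gcd.commute flip: gcd_red_int)
qed

text \<open>The orbits partition the fibre into blocks of equal size \<open>ord d a\<close>, so
  counting the elements of the fibre counts its cycles.\<close>

lemma card_orbits_mult_map:
  assumes d: "d dvd n"
  shows "ord d a * card (orbit (mult_map n (int a)) ` gcd_fibre n d) = totient d"
proof -
  let ?O = "orbit (mult_map n (int a)) ` gcd_fibre n d"
  have U: "\<Union>?O = gcd_fibre n d"
    using orbit_mult_map_subset self_in_orbit_mult_map d by blast
  have "ord d a * card ?O = card (\<Union>?O)"
  proof (rule card_partition)
    show "finite (\<Union>?O)" unfolding U by simp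
    fix C C' assume "C \<in> ?O" "C' \<in> ?O" "C \<noteq> C'"
    then obtain x x' where xx': "x \<in> gcd_fibre n d" "x' \<in> gcd_fibre n d"
      and C: "C = orbit (mult_map n (int a)) x" "C' = orbit (mult_map n (int a)) x'"
      by auto
    \<comment> \<open>Each base point lies in its own orbit, which makes the orbit relation
      symmetric; a shared point \<open>z\<close> then links the two orbits.\<close>
    have "C = C'" if "z \<in> C" "z \<in> C'" for z
      using that xx' self_in_orbit_mult_map [OF _ d] unfolding C
      by (metis orbit_swap orbit_trans subsetI subset_antisym)
    with \<open>C \<noteq> C'\<close> show "C \<inter> C' = {}" by blast
  qed (use d card_orbit_mult_map in auto)
  then show ?thesis using n d by (simp add: U card_gcd_fibre)
qed

lemma ctype_mult_map:
  "ctype (mult_map n (int a)) (residues_mod n) =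
    (\<Prod>d | d dvd n. indet (ord d a) ^ (totient d div ord d a))"
proof -
  let ?f = "mult_map n (int a)"
  have sub: "orbit ?f x \<subseteq> {0..<int n}" if "x \<in> {0..<int n}" for x
    using that orbit_mult_map_subset Union_gcd_fibre [OF n] by blast
  have "orbit ?f ` {0..<int n} = (\<Union>d\<in>{d. d dvd n}. orbit ?f ` gcd_fibre n d)"
    by (simp only: image_UN flip: Union_gcd_fibre [OF n])
  moreover have "ctype ?f {0..<int n} = (\<Prod>C\<in>orbit ?f ` {0..<int n}. indet (card C))"
    using sub by (intro ctype_eq_prod_orbits) auto
  ultimately have "ctype ?f (residues_mod n) =
      (\<Prod>C\<in>(\<Union>d\<in>{d. d dvd n}. orbit ?f ` gcd_fibre n d). indet (card C))"
    using n by (simp only: residues_mod_eq)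
  also have "\<dots> = (\<Prod>d | d dvd n. \<Prod>C\<in>orbit ?f ` gcd_fibre n d. indet (card C))"
  proof (rule prod.UNION_disjoint)
    show "\<forall>d\<in>{d. d dvd n}. \<forall>d'\<in>{d. d dvd n}. d \<noteq> d' \<longrightarrow>
        orbit ?f ` gcd_fibre n d \<inter> orbit ?f ` gcd_fibre n d' = {}"
    proof (intro ballI impI)
      fix d d' assume "d \<in> {d. d dvd n}" "d' \<in> {d. d dvd n}" "d \<noteq> d'"
      then have "gcd_fibre n d \<inter> gcd_fibre n d' = {}"
        using n gcd_fibre_disjoint by blast
      \<comment> \<open>A common orbit would be a nonempty subset of two disjoint fibres.\<close>
      then have "orbit ?f x \<noteq> orbit ?f x'" if "x \<in> gcd_fibre n d" "x' \<in> gcd_fibre n d'" for x x'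
        using that orbit_mult_map_subset orbit_nonempty [of ?f x] by blast
      then show "orbit ?f ` gcd_fibre n d \<inter> orbit ?f ` gcd_fibre n d' = {}" by blast
    qed
  qed (use n in simp_all)
  also have "\<dots> = (\<Prod>d | d dvd n. indet (ord d a) ^ (totient d div ord d a))"
  proof (intro prod.cong refl)
    fix d assume "d \<in> {d. d dvd n}"
    then have d: "d dvd n" by simp
    then have "coprime d a" using a by (metis coprime_divisors dvd_refl)
    then have "ord d a > 0" by simp
    then have "card (orbit ?f ` gcd_fibre n d) = totient d div ord d a"
      by (simp flip: card_orbits_mult_map [OF d])
    moreover have "(\<Prod>C\<in>orbit ?f ` gcd_fibre n d. indet (card C)) =
        (\<Prod>C\<in>orbit ?f ` gcd_fibre n d. indet (ord d a))"
      using card_orbit_mult_map d by (intro prod.cong) auto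
    ultimately show "(\<Prod>C\<in>orbit ?f ` gcd_fibre n d. indet (card C)) =
        indet (ord d a) ^ (totient d div ord d a)" by simp
  qed
  finally show ?thesis .
qed

end

section \<open>Automorphisms as powers of a primitive root\<close>

lemma bij_betw_primroot_aut_residues:
  assumes n: "n > 1" and g: "residue_primroot n g"
  shows "bij_betw (\<lambda>k. mult_map n (int (g ^ k))) {1..totient n} (aut_residues n)"
proof -
  let ?h = "\<lambda>k. mult_map n (int (g ^ k))"
  have cop: "coprime n g" and ord: "ord n g = totient n"
    using g by (auto simp: residue_primroot_def)
  have inj: "inj_on ?h {1..totient n}"
  proof (rule inj_onI)
    fix k l assume kl: "k \<in> {1..totient n}" "l \<in> {1..totient n}" "?h k = ?h l"
    \<comment> \<open>Evaluating at 1, a residue because \<open>n > 1\<close>, recovers the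
      multiplier modulo \<open>n\<close>.\<close>
    then have "?h k 1 = ?h l 1" by simp
    then have "[int (g ^ k) = int (g ^ l)] (mod int n)"
      using n by (simp add: mult_map_def residues_mod_eq cong_def)
    then have "[g ^ k = g ^ l] (mod n)"
      using cong_int_iff by blast
    then have "[k = l] (mod totient n)"
      using order_divides_expdiff [OF cop] ord by simp
    \<comment> \<open>In \<open>{1..totient n}\<close> the class 0 is represented by
      \<open>totient n\<close>, hence the case split.\<close>
    with kl(1,2) show "k = l"
      by (cases "k = totient n"; cases "l = totient n") (auto simp: cong_def)
  qed
  have sub: "?h ` {1..totient n} \<subseteq> aut_residues n"
    using n cop by (auto intro!: mult_map_in_aut_residues simp: coprime_commute)
  have aut: "aut_residues n = mult_map n ` gcd_fibre n n"
    using n by (simp add: aut_residues_eq residues_mod_eq gcd_fibre_def coprime_iff_gcd_eq_1)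
  then have fin: "finite (aut_residues n)" by simp
  have "card (aut_residues n) \<le> totient n"
    using n card_image_le [of "gcd_fibre n n" "mult_map n"] by (simp add: aut card_gcd_fibre)
  \<comment> \<open>Surjectivity by counting: an injective image of size \<open>totient n\<close>
    fills a set of at most that size.\<close>
  then have "?h ` {1..totient n} = aut_residues n"
    using inj by (intro card_seteq fin sub) (simp add: card_image)
  with inj show ?thesis by (simp add: bij_betw_def)
qed

section \<open>The cycle index for odd prime powers\<close>

theorem lemma4p5:
  fixes p m :: nat
  assumes "prime p" and "odd p" and "m \<ge> 1"
  shows "cycle_index (aut_residues (p ^ m)) (residues_mod (p ^ m)) =
    const_poly (1 / of_nat (totient (p ^ m))) *
      (\<Sum>k = 1..totient (p ^ m). \<Prod>i = 0..m.
        indet (totient (p ^ i) div gcd (totient (p ^ i)) k) ^ gcd (totient (p ^ i)) k)"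
proof -
  have p: "p > 1" using assms(1) by (rule prime_gt_1_nat)
  then have n: "p ^ m > 1" using assms(3) by (intro one_less_power) auto
  obtain g where g: "\<forall>k>0. residue_primroot (p ^ k) g"
    using residue_primroot_odd_prime_power_exists assms by metis
  then have gm: "residue_primroot (p ^ m) g" using assms(3) by simp
  then have cop: "coprime (p ^ m) g" by (simp add: residue_primroot_def)
  \<comment> \<open>The choice of \<open>g\<close> covers only positive exponents; for
    \<open>i = 0\<close> the modulus is 1, where order and totient are both 1.\<close>
  have ord: "ord (p ^ i) g = totient (p ^ i)" for i
    using g by (cases "i = 0") (auto simp: residue_primroot_def)
  note bij = bij_betw_primroot_aut_residues [OF n gm]
  \<comment> \<open>Replaces the product over divisors of \<open>p ^ m\<close> by one over exponents
    \<open>0..m\<close>.\<close>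
  have divisors: "bij_betw (\<lambda>i. p ^ i) {0..m} {d. d dvd p ^ m}"
    using assms(1) p
    by (auto simp: bij_betw_def inj_on_def divides_primepow_nat power_inject_exp)
  have "ctype (mult_map (p ^ m) (int (g ^ k))) (residues_mod (p ^ m)) = (\<Prod>i = 0..m.
      indet (totient (p ^ i) div gcd (totient (p ^ i)) k) ^ gcd (totient (p ^ i)) k)" for k
  proof -
    have "ctype (mult_map (p ^ m) (int (g ^ k))) (residues_mod (p ^ m)) =
        (\<Prod>d | d dvd p ^ m. indet (ord d (g ^ k)) ^ (totient d div ord d (g ^ k)))"
      using p cop by (intro ctype_mult_map) auto
    also have "\<dots> = (\<Prod>i = 0..m.
        indet (ord (p ^ i) (g ^ k)) ^ (totient (p ^ i) div ord (p ^ i) (g ^ k)))"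
      by (rule prod.reindex_bij_betw [OF divisors, symmetric])
    also have "\<dots> = (\<Prod>i = 0..m.
      indet (totient (p ^ i) div gcd (totient (p ^ i)) k) ^ gcd (totient (p ^ i)) k)"
    proof (intro prod.cong refl)
      fix i
      let ?t = "totient (p ^ i)" and ?o = "ord (p ^ i) (g ^ k)"
      \<comment> \<open>Dividing by one factor gives the cycle length, by the other the number of
        cycles.\<close>
      have eq: "?o * gcd ?t k = ?t"
        using ord_power_aux [of "p ^ i" g k] by (simp add: ord gcd.commute)
      have "?t > 0" using p by simp
      then have "?o = ?t div gcd ?t k" "?t div ?o = gcd ?t k"
        using eq by (metis nonzero_mult_div_cancel_left nonzero_mult_div_cancel_right
          mult_eq_0_iff neq0_conv)+
      then show "indet ?o ^ (?t div ?o) = indet (?t div gcd ?t k) ^ gcd ?t k" by metis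
    qed
    finally show ?thesis .
  qed
  then have "(\<Sum>\<pi>\<in>aut_residues (p ^ m). ctype \<pi> (residues_mod (p ^ m))) =
      (\<Sum>k = 1..totient (p ^ m). \<Prod>i = 0..m.
        indet (totient (p ^ i) div gcd (totient (p ^ i)) k) ^ gcd (totient (p ^ i)) k)"
    using sum.reindex_bij_betw [OF bij, of "\<lambda>\<pi>. ctype \<pi> (residues_mod (p ^ m))"] by simp
  moreover have "card (aut_residues (p ^ m)) = totient (p ^ m)"
    using bij_betw_same_card [OF bij] by simp
  ultimately show ?thesis by (simp add: cycle_index_def)
qed

end
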